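(* Let $\{n_d\}_{d\ge 2}\subseteq\mathbb{N}$ be a non-decreasing sequence. For every integer $d\ge 2$ let $\mathbf{U}^{(d)}_1,\ldots,\mathbf{U}^{(d)}_{n_d}$ be i.i.d. $\mathrm{Unif}(S^{d-1})$ random variables and let $\mathbf{L}^{(d)}=(L^{(d)}_1,\ldots,L^{(d)}_{n_d})$ be a random vector of non-negative real random variables, such that $\mathbf{U}^{(d)}_1,\ldots,\mathbf{U}^{(d)}_{n_d}$ and $\mathbf{L}^{(d)}$ are independent. Set $\mathbf{S}_{d,n_d}:=\sum_{k=1}^{n_d}L^{(d)}_k\mathbf{U}^{(d)}_k$. Assume there exists a function $\psi:\mathbb{R}^+\to\mathbb{R}^+$ such that $$\mathbb{E}\left[L^{(d)}_iL^{(d)}_j\right]\le\psi(d)\quad\text{for all } d\ge 2 \text{ and all } i\ne j\in\{1,\ldots,n_d\},$$ $$\lim_{d\to+\infty}d^{-1/2}\psi(d)\,n_d^2=0.$$ Then for every $\varepsilon>0$ $$\lim_{d\to+\infty}\mathbb{P}\left(\left||\mathbf{S}_{d,n_d}|_2^2-|\mathbf{L}^{(d)}|_2^2\right|>\varepsilon\right)=0.$$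
   Context: $\mathbb{N}$ denotes the positive integers and $\mathbb{R}^+=[0,\infty)$. All random variables are defined on a complete probability space $(\Omega,\mathcal{F},\mathbb{P})$. $|\cdot|_2$ denotes the Euclidean norm and $S^{d-1}=\{\mathbf{x}\in\mathbb{R}^d: |\mathbf{x}|_2=1\}$. An $\mathbb{R}^d$-valued random variable $\mathbf{V}$ ($d\ge2$) has distribution $\mathrm{Unif}(S^{d-1})$ if there are i.i.d. standard Gaussian real random variables $Z_1,\ldots,Z_d$ such that $\mathbf{V}$ has the same law as $\left(Z_1,\ldots,Z_d\right)/\sqrt{\sum_{h=1}^d Z_h^2}$. The components of $\mathbf{L}^{(d)}$ may be dependent on one another. "$\mathbf{U}^{(d)}_1,\ldots,\mathbf{U}^{(d)}_{n_d}$ and $\mathbf{L}^{(d)}$ are independent" means that these $n_d+1$ random vectors are mutually independent, for each fixed $d$. *)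

theory Defs
  imports "HOL-Probability.Probability"
begin

(* R^d, for a dimension d that varies, is the product space with index set {1..d}: its points
   are the functions nat => real that are undefined outside {1..d}. The product
   sigma-algebra is the Borel sigma-algebra of R^d. *)
abbreviation euclid :: "nat \<Rightarrow> (nat \<Rightarrow> real) measure" where
  "euclid d \<equiv> \<Pi>\<^sub>M i\<in>{1..d}. borel"

abbreviation enorm :: "nat \<Rightarrow> (nat \<Rightarrow> real) \<Rightarrow> real" where
  "enorm d x \<equiv> L2_set x {1..d}"

(* The Gaussian variables live on the same probability space M as V, following the convention
   that all random variables are defined on one space. *)
definition unif_sphere :: "'a measure \<Rightarrow> nat \<Rightarrow> ('a \<Rightarrow> nat \<Rightarrow> real) \<Rightarrow> bool" where
  "unif_sphere M d V \<longleftrightarrow>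
     V \<in> M \<rightarrow>\<^sub>M euclid d \<and>
     (\<exists>Z :: nat \<Rightarrow> 'a \<Rightarrow> real.
        prob_space.indep_vars M (\<lambda>_. borel) Z {1..d} \<and>
        (\<forall>i\<in>{1..d}. distributed M lborel (Z i) (\<lambda>x. ennreal (std_normal_density x))) \<and>
        distr M (euclid d) V =
        distr M (euclid d) (\<lambda>\<omega>. \<lambda>i\<in>{1..d}. Z i \<omega> / sqrt (\<Sum>h = 1..d. (Z h \<omega>)\<^sup>2)))"

(* Mutual independence of the m + 1 random vectors L (in R^m) and U 1, ..., U m (in R^d);
   the index 0 of the family stands for L. Measurability is part of indep_vars. *)
definition indep_vectors ::
  "'a measure \<Rightarrow> nat \<Rightarrow> nat \<Rightarrow> (nat \<Rightarrow> 'a \<Rightarrow> nat \<Rightarrow> real) \<Rightarrow> ('a \<Rightarrow> nat \<Rightarrow> real) \<Rightarrow> bool" where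
  "indep_vectors M d m U L \<longleftrightarrow>
     prob_space.indep_vars M
       (\<lambda>k. if k = 0 then euclid m else euclid d)
       (\<lambda>k. if k = 0 then L else U k)
       {0..m}"

definition weighted_sum ::
  "nat \<Rightarrow> nat \<Rightarrow> (nat \<Rightarrow> 'a \<Rightarrow> nat \<Rightarrow> real) \<Rightarrow> ('a \<Rightarrow> nat \<Rightarrow> real) \<Rightarrow> 'a \<Rightarrow> nat \<Rightarrow> real" where
  "weighted_sum d m U L \<omega> = (\<lambda>i\<in>{1..d}. \<Sum>k = 1..m. L \<omega> k * U k \<omega> i)"

end

theory Submission
  imports Defs
begin

text \<open>
  Expand the squared norm of \<open>S = \<Sum>k. L\<^sub>k U\<^sub>k\<close>. The directions are unit vectors almost surely, so
  the diagonal part is exactly \<open>|L|\<^sup>2\<close>, and the deviation is the off-diagonal part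
  \<open>\<Sum>i \<noteq> j. L\<^sub>i L\<^sub>j \<langle>U\<^sub>i, U\<^sub>j\<rangle>\<close> (lemma \<open>weighted_sum_norm_deviation\<close>).

  The idea is that independent random directions in high dimension are nearly orthogonal. A
  uniform point \<open>V\<close> of the sphere satisfies \<open>E (V\<^sub>a V\<^sub>b) = 0\<close> for \<open>a \<noteq> b\<close> and \<open>E (V\<^sub>a\<^sup>2) = 1 / d\<close>
  (lemma \<open>unif_sphere_moments\<close>), which follows from the symmetries of the Gaussian vector. For
  independent \<open>V\<close> and \<open>W\<close> this gives \<open>E \<langle>V, W\<rangle>\<^sup>2 = 1 / d\<close>
  (lemma \<open>unif_sphere_inner_second_moment\<close>), and so \<open>E |\<langle>V, W\<rangle>| \<le> 1 / sqrt d\<close>.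

  Since the lengths are independent of the directions, every off-diagonal term has expected
  absolute value at most \<open>\<psi>(d) / sqrt d\<close>, and there are fewer than \<open>n\<^sub>d\<^sup>2\<close> of them. The expected absolute
  deviation is therefore at most \<open>\<psi>(d) n\<^sub>d\<^sup>2 / sqrt d\<close> (lemma \<open>expected_norm_deviation\<close>). This tends
  to zero by assumption, and Markov's inequality turns it into convergence in probability.
\<close>

section \<open>Second moments of a uniform point of the sphere\<close>

text \<open>
  Independence makes the joint law the product of the marginals, so the marginals determine it.
\<close>

lemma (in prob_space) distr_indep_vars_eqI:
  assumes I: "I \<noteq> {}"
    and X: "indep_vars N X I" and Y: "indep_vars N Y I"
    and eq: "\<And>i. i \<in> I \<Longrightarrow> distr M (N i) (X i) = distr M (N i) (Y i)"
  shows "distr M (PiM I N) (\<lambda>\<omega>. \<lambda>i\<in>I. X i \<omega>) = distr M (PiM I N) (\<lambda>\<omega>. \<lambda>i\<in>I. Y i \<omega>)"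
proof -
  have "distr M (PiM I N) (\<lambda>\<omega>. \<lambda>i\<in>I. X i \<omega>) = PiM I (\<lambda>i. distr M (N i) (X i))"
    using indep_vars_iff_distr_eq_PiM'[of I X N] I X by (auto simp: indep_vars_def)
  also have "\<dots> = PiM I (\<lambda>i. distr M (N i) (Y i))"
    by (rule PiM_cong) (use eq in auto)
  also have "\<dots> = distr M (PiM I N) (\<lambda>\<omega>. \<lambda>i\<in>I. Y i \<omega>)"
    using indep_vars_iff_distr_eq_PiM'[of I Y N] I Y by (auto simp: indep_vars_def)
  finally show ?thesis .
qed

lemma (in prob_space) indep_vars_reindex_inj:
  assumes X: "indep_vars N X I" and inj: "inj_on \<pi> J" and sub: "\<pi> ` J \<subseteq> I"
  shows "indep_vars (\<lambda>j. N (\<pi> j)) (\<lambda>j. X (\<pi> j)) J"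
proof -
  \<comment> \<open>Group the family into the disjoint singleton blocks \<open>{\<pi> j}\<close>, then read off their only entry.\<close>
  have "indep_vars (\<lambda>j. PiM {\<pi> j} N) (\<lambda>j \<omega>. restrict (\<lambda>i. X i \<omega>) {\<pi> j}) J"
    by (rule indep_vars_restrict[OF X])
      (use inj sub in \<open>auto simp: disjoint_family_on_def inj_on_def\<close>)
  then have "indep_vars (\<lambda>j. N (\<pi> j)) (\<lambda>j \<omega>. (restrict (\<lambda>i. X i \<omega>) {\<pi> j}) (\<pi> j)) J"
    by (rule indep_vars_compose2) (auto intro: measurable_component_singleton)
  then show ?thesis
    by simp
qed

definition std_gaussian_vector :: "'a measure \<Rightarrow> nat \<Rightarrow> (nat \<Rightarrow> 'a \<Rightarrow> real) \<Rightarrow> bool" where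
  "std_gaussian_vector M d Z \<longleftrightarrow>
     prob_space.indep_vars M (\<lambda>_. borel) Z {1..d} \<and>
     (\<forall>i\<in>{1..d}. distributed M lborel (Z i) (\<lambda>x. ennreal (std_normal_density x)))"

lemma std_gaussian_vector_measurable:
  assumes "std_gaussian_vector M d Z" "i \<in> {1..d}"
  shows "Z i \<in> borel_measurable M"
  using assms unfolding std_gaussian_vector_def
  by (auto simp: distributed_def)

text \<open>
  This is how symmetry enters: any transformation that turns a standard Gaussian vector into
  another one leaves all expectations of functions of the vector unchanged.
\<close>

lemma (in prob_space) std_gaussian_vector_expectation_eq:
  fixes f :: "(nat \<Rightarrow> real) \<Rightarrow> real"
  assumes "d \<ge> 1" and Z: "std_gaussian_vector M d Z" and W: "std_gaussian_vector M d W"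
    and f: "f \<in> borel_measurable (euclid d)"
  shows "expectation (\<lambda>\<omega>. f (\<lambda>i\<in>{1..d}. Z i \<omega>)) = expectation (\<lambda>\<omega>. f (\<lambda>i\<in>{1..d}. W i \<omega>))"
proof -
  have eq: "distr M (euclid d) (\<lambda>\<omega>. \<lambda>i\<in>{1..d}. Z i \<omega>) = distr M (euclid d) (\<lambda>\<omega>. \<lambda>i\<in>{1..d}. W i \<omega>)"
  proof (rule distr_indep_vars_eqI)
    fix i assume i: "i \<in> {1..d}"
    have "distr M lborel (Z i) = distr M lborel (W i)"
      using Z W i by (auto simp: std_gaussian_vector_def distributed_def)
    then show "distr M borel (Z i) = distr M borel (W i)"
      by (metis distr_cong sets_lborel)
  qed (use Z W \<open>d \<ge> 1\<close> in \<open>auto simp: std_gaussian_vector_def\<close>)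
  have meas: "(\<lambda>\<omega>. \<lambda>i\<in>{1..d}. X i \<omega>) \<in> M \<rightarrow>\<^sub>M euclid d" if "std_gaussian_vector M d X" for X
    by (rule measurable_restrict) (rule std_gaussian_vector_measurable[OF that])
  have "expectation (\<lambda>\<omega>. f (\<lambda>i\<in>{1..d}. X i \<omega>)) =
      integral\<^sup>L (distr M (euclid d) (\<lambda>\<omega>. \<lambda>i\<in>{1..d}. X i \<omega>)) f"
    if "std_gaussian_vector M d X" for X
    by (rule integral_distr[symmetric, OF meas[OF that] f])
  then show ?thesis
    using Z W eq by simp
qed

lemma (in prob_space) std_gaussian_vector_flip:
  assumes Z: "std_gaussian_vector M d Z"
  shows "std_gaussian_vector M d (\<lambda>i \<omega>. if i = a then - Z i \<omega> else Z i \<omega>)"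
  unfolding std_gaussian_vector_def
proof (intro conjI ballI)
  have "indep_vars (\<lambda>_. borel) (\<lambda>i \<omega>. (\<lambda>x. if i = a then - x else x) (Z i \<omega>)) {1..d}"
    by (rule indep_vars_compose2[where M' = "\<lambda>_. borel"])
      (use Z in \<open>auto simp: std_gaussian_vector_def\<close>)
  then show "indep_vars (\<lambda>_. borel) (\<lambda>i \<omega>. if i = a then - Z i \<omega> else Z i \<omega>) {1..d}"
    by simp
next
  fix i assume "i \<in> {1..d}"
  then have Zi: "distributed M lborel (Z i) (\<lambda>x. ennreal (std_normal_density x))"
    using Z by (auto simp: std_gaussian_vector_def)
  have "distributed M lborel (\<lambda>\<omega>. 0 + (-1) * Z i \<omega>)
      (\<lambda>x. ennreal (normal_density (0 + (-1) * 0) (\<bar>-1\<bar> * 1) x))"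
    by (rule normal_density_affine) (use Zi in auto)
  with Zi show "distributed M lborel (\<lambda>\<omega>. if i = a then - Z i \<omega> else Z i \<omega>)
      (\<lambda>x. ennreal (std_normal_density x))"
    by (cases "i = a") auto
qed

lemma (in prob_space) std_gaussian_vector_permute:
  assumes Z: "std_gaussian_vector M d Z" and \<pi>: "\<pi> permutes {1..d}"
  shows "std_gaussian_vector M d (\<lambda>i. Z (\<pi> i))"
  using Z indep_vars_reindex_inj[of "\<lambda>_. borel" Z "{1..d}" \<pi> "{1..d}"]
    permutes_inj_on[OF \<pi>] permutes_image[OF \<pi>] permutes_in_image[OF \<pi>]
  unfolding std_gaussian_vector_def by auto

text \<open>
  The quotient \<open>Z / |Z|\<close> that defines the uniform law is the zero vector where \<open>Z\<close> vanishes,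
  because division by zero yields zero. This lemma makes that event negligible.
\<close>

lemma (in prob_space) std_gaussian_vector_nonzero:
  assumes "d \<ge> 1" and Z: "std_gaussian_vector M d Z"
  shows "AE \<omega> in M. (\<Sum>h = 1..d. (Z h \<omega>)\<^sup>2) \<noteq> 0"
proof -
  have D: "distributed M lborel (Z 1) (\<lambda>x. ennreal (std_normal_density x))"
    using Z \<open>d \<ge> 1\<close> by (auto simp: std_gaussian_vector_def)
  have "AE \<omega> in M. Z 1 \<omega> \<noteq> 0"
    by (subst distributed_AE2[OF D]) (auto intro: AE_mp[OF AE_lborel_singleton[of 0]])
  then show ?thesis
  proof eventually_elim
    case (elim \<omega>)
    have "(Z 1 \<omega>)\<^sup>2 \<le> (\<Sum>h = 1..d. (Z h \<omega>)\<^sup>2)"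
      by (rule member_le_sum) (use \<open>d \<ge> 1\<close> in auto)
    with elim show ?case
      by (smt (verit) zero_less_power2)
  qed
qed

text \<open>
  Changing the sign of one coordinate preserves the law and turns a mixed moment into its
  negative, so it vanishes. Exchanging two coordinates shows that
  the \<open>d\<close> diagonal moments agree; they sum to 1, so each of them is \<open>1 / d\<close>.
\<close>

lemma (in prob_space) std_gaussian_direction_moments:
  assumes d: "d \<ge> 1" and Z: "std_gaussian_vector M d Z" and ab: "a \<in> {1..d}" "b \<in> {1..d}"
  shows "expectation (\<lambda>\<omega>. Z a \<omega> * Z b \<omega> / (\<Sum>h = 1..d. (Z h \<omega>)\<^sup>2)) =
    (if a = b then 1 / real d else 0)"
proof -
  let ?q = "\<lambda>X \<omega>. \<Sum>h = 1..d. (X h \<omega>)\<^sup>2 :: real"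
  have inv: "expectation (\<lambda>\<omega>. W i \<omega> * W j \<omega> / ?q W \<omega>) = expectation (\<lambda>\<omega>. Z i \<omega> * Z j \<omega> / ?q Z \<omega>)"
    if "std_gaussian_vector M d W" "i \<in> {1..d}" "j \<in> {1..d}" for W i j
  proof -
    have "(\<lambda>z. z i * z j / (\<Sum>h = 1..d. (z h)\<^sup>2)) \<in> borel_measurable (euclid d)"
      using that by measurable
    from std_gaussian_vector_expectation_eq[OF d that(1) Z this] that show ?thesis
      by simp
  qed
  have Zm[measurable]: "Z i \<in> borel_measurable M" if "i \<in> {1..d}" for i
    using std_gaussian_vector_measurable[OF Z that] .
  show ?thesis
  proof (cases "a = b")
    case False
    have flip: "?q (\<lambda>i \<omega>. if i = a then - Z i \<omega> else Z i \<omega>) \<omega> = ?q Z \<omega>" for \<omega>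
      by (rule sum.cong) auto
    have "expectation (\<lambda>\<omega>. - (Z a \<omega> * Z b \<omega> / ?q Z \<omega>)) = expectation (\<lambda>\<omega>. Z a \<omega> * Z b \<omega> / ?q Z \<omega>)"
      using inv[OF std_gaussian_vector_flip[OF Z, of a] ab] False unfolding flip by simp
    then show ?thesis
      using False by simp
  next
    case True
    have same: "expectation (\<lambda>\<omega>. Z i \<omega> * Z i \<omega> / ?q Z \<omega>) = expectation (\<lambda>\<omega>. Z a \<omega> * Z a \<omega> / ?q Z \<omega>)"
      if i: "i \<in> {1..d}" for i
    proof -
      let ?\<pi> = "Transposition.transpose a i"
      have \<pi>: "?\<pi> permutes {1..d}"
        using ab i by (rule_tac permutes_swap_id) auto
      have "?q (\<lambda>h. Z (?\<pi> h)) \<omega> = ?q Z \<omega>" for \<omega>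
        using sum.permute[OF \<pi>, of "\<lambda>h. (Z h \<omega>)\<^sup>2"] by (simp add: o_def)
      with inv[OF std_gaussian_vector_permute[OF Z \<pi>] ab(1) ab(1)] show ?thesis
        by simp
    qed
    have int: "integrable M (\<lambda>\<omega>. Z i \<omega> * Z i \<omega> / ?q Z \<omega>)" if i: "i \<in> {1..d}" for i
    proof (rule integrable_const_bound[where B = 1])
      have "(Z i \<omega>)\<^sup>2 \<le> ?q Z \<omega>" for \<omega>
        by (rule member_le_sum) (use i in auto)
      then show "AE \<omega> in M. norm (Z i \<omega> * Z i \<omega> / ?q Z \<omega>) \<le> 1"
        by (intro AE_I2) (simp add: power2_eq_square[symmetric] divide_le_eq_1 sum_nonneg, smt (verit) zero_le_power2)
    qed (use i in measurable)
    have "real d * expectation (\<lambda>\<omega>. Z a \<omega> * Z a \<omega> / ?q Z \<omega>) =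
        (\<Sum>i = 1..d. expectation (\<lambda>\<omega>. Z i \<omega> * Z i \<omega> / ?q Z \<omega>))"
      using same by simp
    also have "\<dots> = expectation (\<lambda>\<omega>. \<Sum>i = 1..d. Z i \<omega> * Z i \<omega> / ?q Z \<omega>)"
      by (rule Bochner_Integration.integral_sum[symmetric]) (rule int)
    also have "\<dots> = expectation (\<lambda>\<omega>. 1)"
    proof (rule integral_cong_AE)
      show "AE \<omega> in M. (\<Sum>i = 1..d. Z i \<omega> * Z i \<omega> / ?q Z \<omega>) = 1"
        using std_gaussian_vector_nonzero[OF d Z]
        by eventually_elim (simp add: sum_divide_distrib[symmetric] power2_eq_square)
    qed measurable
    finally show ?thesis
      using True d by (simp add: field_simps prob_space)
  qed
qed

lemma (in prob_space) std_gaussian_direction_measurable: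
  assumes "std_gaussian_vector M d Z"
  shows "(\<lambda>\<omega>. \<lambda>i\<in>{1..d}. Z i \<omega> / sqrt (\<Sum>h = 1..d. (Z h \<omega>)\<^sup>2)) \<in> M \<rightarrow>\<^sub>M euclid d"
  by (intro measurable_restrict borel_measurable_divide borel_measurable_sum
      borel_measurable_power measurable_compose[OF _ borel_measurable_sqrt]
      std_gaussian_vector_measurable[OF assms])

text \<open>
  The variable \<open>V\<close> itself need not be a normalised Gaussian vector; it only has the same law, so
  both this lemma and the next one pass through the image measure.
\<close>

lemma (in prob_space) unif_sphere_moments:
  assumes d: "d \<ge> 1" and V: "unif_sphere M d V" and ab: "a \<in> {1..d}" "b \<in> {1..d}"
  shows "expectation (\<lambda>\<omega>. V \<omega> a * V \<omega> b) = (if a = b then 1 / real d else 0)"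
proof -
  obtain Z where Z: "std_gaussian_vector M d Z" and Vm: "V \<in> M \<rightarrow>\<^sub>M euclid d"
    and law: "distr M (euclid d) V =
        distr M (euclid d) (\<lambda>\<omega>. \<lambda>i\<in>{1..d}. Z i \<omega> / sqrt (\<Sum>h = 1..d. (Z h \<omega>)\<^sup>2))"
    using V unfolding unif_sphere_def std_gaussian_vector_def by blast
  have f: "(\<lambda>x. x a * x b :: real) \<in> borel_measurable (euclid d)"
    using ab by measurable
  have "expectation (\<lambda>\<omega>. V \<omega> a * V \<omega> b) = integral\<^sup>L (distr M (euclid d) V) (\<lambda>x. x a * x b)"
    by (rule integral_distr[symmetric, OF Vm f])
  also have "\<dots> = expectation (\<lambda>\<omega>. Z a \<omega> / sqrt (\<Sum>h = 1..d. (Z h \<omega>)\<^sup>2) *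
      (Z b \<omega> / sqrt (\<Sum>h = 1..d. (Z h \<omega>)\<^sup>2)))"
    unfolding law integral_distr[OF std_gaussian_direction_measurable[OF Z] f]
    using ab by simp
  also have "\<dots> = expectation (\<lambda>\<omega>. Z a \<omega> * Z b \<omega> / (\<Sum>h = 1..d. (Z h \<omega>)\<^sup>2))"
    by (simp add: sum_nonneg)
  finally show ?thesis
    using std_gaussian_direction_moments[OF d Z ab] by simp
qed

lemma (in prob_space) unif_sphere_norm:
  assumes d: "d \<ge> 1" and V: "unif_sphere M d V"
  shows "AE \<omega> in M. (\<Sum>i = 1..d. (V \<omega> i)\<^sup>2) = 1"
proof -
  obtain Z where Z: "std_gaussian_vector M d Z" and Vm[measurable]: "V \<in> M \<rightarrow>\<^sub>M euclid d"
    and law: "distr M (euclid d) V =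
        distr M (euclid d) (\<lambda>\<omega>. \<lambda>i\<in>{1..d}. Z i \<omega> / sqrt (\<Sum>h = 1..d. (Z h \<omega>)\<^sup>2))"
    using V unfolding unif_sphere_def std_gaussian_vector_def by blast
  let ?P = "\<lambda>x. (\<Sum>i = 1..d. (x i)\<^sup>2) = (1::real)"
  have P: "{x \<in> space (euclid d). ?P x} \<in> sets (euclid d)"
    by measurable
  have "AE \<omega> in M. ?P (\<lambda>i\<in>{1..d}. Z i \<omega> / sqrt (\<Sum>h = 1..d. (Z h \<omega>)\<^sup>2))"
    using std_gaussian_vector_nonzero[OF d Z]
  proof eventually_elim
    case (elim \<omega>)
    have "(\<Sum>i = 1..d. (Z i \<omega> / sqrt (\<Sum>h = 1..d. (Z h \<omega>)\<^sup>2))\<^sup>2) =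
        (\<Sum>i = 1..d. (Z i \<omega>)\<^sup>2 / (\<Sum>h = 1..d. (Z h \<omega>)\<^sup>2))"
      by (simp add: power_divide sum_nonneg)
    also have "\<dots> = (\<Sum>i = 1..d. (Z i \<omega>)\<^sup>2) / (\<Sum>h = 1..d. (Z h \<omega>)\<^sup>2)"
      by (rule sum_divide_distrib[symmetric])
    also have "\<dots> = 1"
      using elim by (rule divide_self)
    finally show ?case
      by simp
  qed
  then have "AE x in distr M (euclid d) V. ?P x"
    unfolding law AE_distr_iff[OF std_gaussian_direction_measurable[OF Z] P] .
  then show ?thesis
    by (subst (asm) AE_distr_iff[OF Vm P])
qed

lemma (in prob_space) unif_sphere_product_integrable:
  assumes d: "d \<ge> 1" and V: "unif_sphere M d V" and ab: "a \<in> {1..d}" "b \<in> {1..d}"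
  shows "integrable M (\<lambda>\<omega>. V \<omega> a * V \<omega> b)"
proof (rule integrable_const_bound[where B = 1])
  have Vm: "V \<in> M \<rightarrow>\<^sub>M euclid d"
    using V by (simp add: unif_sphere_def)
  have "(\<lambda>\<omega>. V \<omega> i) \<in> borel_measurable M" if "i \<in> {1..d}" for i
    using measurable_compose[OF Vm measurable_component_singleton[OF that]] .
  then show "(\<lambda>\<omega>. V \<omega> a * V \<omega> b) \<in> borel_measurable M"
    using ab by (intro borel_measurable_times)
  show "AE \<omega> in M. norm (V \<omega> a * V \<omega> b) \<le> 1"
    using unif_sphere_norm[OF d V]
  proof eventually_elim
    case (elim \<omega>)
    have "\<bar>V \<omega> i\<bar> \<le> 1" if "i \<in> {1..d}" for i
    proof -
      have "(V \<omega> i)\<^sup>2 \<le> (\<Sum>i = 1..d. (V \<omega> i)\<^sup>2)"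
        by (rule member_le_sum) (use that in auto)
      then show ?thesis
        unfolding elim by (simp add: abs_square_le_1)
    qed
    from this[OF ab(1)] this[OF ab(2)] show ?case
      by (simp add: abs_mult mult_le_one)
  qed
qed

section \<open>Near-orthogonality of independent directions\<close>

text \<open>
  Expanding the square gives \<open>\<Sum>a b. E (V\<^sub>a V\<^sub>b) E (W\<^sub>a W\<^sub>b)\<close> by independence. Only the \<open>d\<close> diagonal
  terms survive, each equal to \<open>1 / d\<^sup>2\<close>. So two independent directions have an inner product of
  typical size \<open>1 / sqrt d\<close>, which is the source of the factor \<open>d\<close> to the power \<open>-1/2\<close> in the theorem.
\<close>

lemma (in prob_space) unif_sphere_inner_second_moment:
  assumes d: "d \<ge> 1" and V: "unif_sphere M d V" and W: "unif_sphere M d W"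
    and ind: "indep_var (euclid d) V (euclid d) W"
  shows "integrable M (\<lambda>\<omega>. (\<Sum>i = 1..d. V \<omega> i * W \<omega> i)\<^sup>2)"
    and "expectation (\<lambda>\<omega>. (\<Sum>i = 1..d. V \<omega> i * W \<omega> i)\<^sup>2) = 1 / real d"
proof -
  have expand: "(\<Sum>i = 1..d. V \<omega> i * W \<omega> i)\<^sup>2 =
      (\<Sum>a = 1..d. \<Sum>b = 1..d. (V \<omega> a * V \<omega> b) * (W \<omega> a * W \<omega> b))" for \<omega>
    by (simp add: power2_eq_square sum_product mult_ac)
  have ind_ab: "indep_var borel (\<lambda>\<omega>. V \<omega> a * V \<omega> b) borel (\<lambda>\<omega>. W \<omega> a * W \<omega> b)"
    if "a \<in> {1..d}" "b \<in> {1..d}" for a b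
  proof -
    have f: "(\<lambda>x. x a * x b :: real) \<in> borel_measurable (euclid d)"
      using that by measurable
    from indep_var_compose[OF ind f f] show ?thesis
      by (simp add: o_def)
  qed
  note int = unif_sphere_product_integrable[OF d V] unif_sphere_product_integrable[OF d W]
  have int_ab: "integrable M (\<lambda>\<omega>. (V \<omega> a * V \<omega> b) * (W \<omega> a * W \<omega> b))"
    if "a \<in> {1..d}" "b \<in> {1..d}" for a b
    by (rule indep_var_integrable[OF ind_ab[OF that] int(1)[OF that] int(2)[OF that]])
  show "integrable M (\<lambda>\<omega>. (\<Sum>i = 1..d. V \<omega> i * W \<omega> i)\<^sup>2)"
    unfolding expand by (intro Bochner_Integration.integrable_sum int_ab)
  have "expectation (\<lambda>\<omega>. (\<Sum>i = 1..d. V \<omega> i * W \<omega> i)\<^sup>2) =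
      (\<Sum>a = 1..d. expectation (\<lambda>\<omega>. \<Sum>b = 1..d. (V \<omega> a * V \<omega> b) * (W \<omega> a * W \<omega> b)))"
    unfolding expand
    by (intro Bochner_Integration.integral_sum Bochner_Integration.integrable_sum int_ab)
  also have "\<dots> = (\<Sum>a = 1..d. \<Sum>b = 1..d. expectation (\<lambda>\<omega>. (V \<omega> a * V \<omega> b) * (W \<omega> a * W \<omega> b)))"
    by (intro sum.cong refl Bochner_Integration.integral_sum int_ab)
  also have "\<dots> = (\<Sum>a = 1..d. \<Sum>b = 1..d.
      expectation (\<lambda>\<omega>. V \<omega> a * V \<omega> b) * expectation (\<lambda>\<omega>. W \<omega> a * W \<omega> b))"
    by (intro sum.cong refl indep_var_lebesgue_integral ind_ab int)
  also have "\<dots> = (\<Sum>a = 1..d. \<Sum>b = 1..d. if a = b then (1 / real d)\<^sup>2 else 0)"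
    by (intro sum.cong refl) (simp add: unif_sphere_moments[OF d V] unif_sphere_moments[OF d W] power2_eq_square)
  also have "\<dots> = 1 / real d"
    using d by (simp add: power2_eq_square)
  finally show "expectation (\<lambda>\<omega>. (\<Sum>i = 1..d. V \<omega> i * W \<omega> i)\<^sup>2) = 1 / real d" .
qed

lemma (in prob_space) nn_integral_abs_le_sqrt_second_moment:
  fixes X :: "'a \<Rightarrow> real"
  assumes [measurable]: "X \<in> borel_measurable M" and X2: "integrable M (\<lambda>\<omega>. (X \<omega>)\<^sup>2)"
  shows "(\<integral>\<^sup>+ \<omega>. ennreal \<bar>X \<omega>\<bar> \<partial>M) \<le> ennreal (sqrt (expectation (\<lambda>\<omega>. (X \<omega>)\<^sup>2)))"
proof -
  have int: "integrable M (\<lambda>\<omega>. \<bar>X \<omega>\<bar>)"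
    by (rule integrable_abs[OF square_integrable_imp_integrable[OF assms(1) X2]])
  have "0 \<le> expectation (\<lambda>\<omega>. (X \<omega>)\<^sup>2) - (expectation (\<lambda>\<omega>. \<bar>X \<omega>\<bar>))\<^sup>2"
    using variance_eq[OF int] variance_positive[of "\<lambda>\<omega>. \<bar>X \<omega>\<bar>"] X2 by simp
  then have "expectation (\<lambda>\<omega>. \<bar>X \<omega>\<bar>) \<le> sqrt (expectation (\<lambda>\<omega>. (X \<omega>)\<^sup>2))"
    by (intro real_le_rsqrt) simp
  with int show ?thesis
    by (simp add: nn_integral_eq_integral ennreal_leI)
qed

text \<open>
  The product rule takes this form, with values in the extended nonnegative reals, because it is
  applied to products of lengths whose expectation may be infinite.
\<close>

lemma (in prob_space) indep_var_nn_integral: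
  fixes X Y :: "'a \<Rightarrow> ennreal"
  assumes "indep_var borel X borel Y"
  shows "(\<integral>\<^sup>+ \<omega>. X \<omega> * Y \<omega> \<partial>M) = (\<integral>\<^sup>+ \<omega>. X \<omega> \<partial>M) * (\<integral>\<^sup>+ \<omega>. Y \<omega> \<partial>M)"
proof -
  have "case_bool borel borel = (\<lambda>_. borel :: ennreal measure)"
    by (rule ext) (simp split: bool.split)
  then have "indep_vars (\<lambda>_. borel) (case_bool X Y) UNIV"
    using assms unfolding indep_var_def by simp
  from indep_vars_nn_integral[OF _ this] show ?thesis
    by (simp add: UNIV_bool mult.commute)
qed

section \<open>Expected deviation of the squared norm\<close>

text \<open>
  The lengths may depend on each other, but the pair \<open>(U i, U j)\<close> is independent of all of them.
  Hence the expectation splits, and the factor with the directions is at most the square root of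
  its second moment.
\<close>

lemma (in prob_space) weighted_inner_product_bound:
  assumes d: "d \<ge> 1" and U: "\<And>k. k \<in> {1..m} \<Longrightarrow> unif_sphere M d (U k)"
    and ind: "indep_vectors M d m U L"
    and ij: "i \<in> {1..m}" "j \<in> {1..m}" "i \<noteq> j"
    and L: "\<And>\<omega>. \<omega> \<in> space M \<Longrightarrow> L \<omega> i * L \<omega> j \<ge> 0"
  shows "(\<integral>\<^sup>+ \<omega>. ennreal \<bar>L \<omega> i * L \<omega> j * (\<Sum>a = 1..d. U i \<omega> a * U j \<omega> a)\<bar> \<partial>M) \<le>
    (\<integral>\<^sup>+ \<omega>. ennreal (L \<omega> i * L \<omega> j) \<partial>M) * ennreal (1 / sqrt (real d))"
proof -
  let ?N = "\<lambda>k. if k = 0 then euclid m else euclid d" and ?X = "\<lambda>k. if k = 0 then L else U k"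
  \<comment> \<open>Write both factors as functions of disjoint blocks of the family \<open>L, U 1, \<dots>, U m\<close>: the block
    with index 0 and the block with indices \<open>i\<close> and \<open>j\<close>.\<close>
  let ?f = "\<lambda>x. ennreal (x 0 i * x 0 j)"
    and ?g = "\<lambda>x. ennreal \<bar>\<Sum>a = 1..d. x i a * x j a\<bar>"
  have ind': "indep_vars ?N ?X {0..m}"
    using ind by (simp add: indep_vectors_def)
  have "indep_var (PiM {0} ?N) (\<lambda>\<omega>. restrict (\<lambda>k. ?X k \<omega>) {0})
      (PiM {i, j} ?N) (\<lambda>\<omega>. restrict (\<lambda>k. ?X k \<omega>) {i, j})"
    by (rule indep_var_restrict[OF ind']) (use ij in auto)
  moreover have "?f \<in> borel_measurable (PiM {0} ?N)"
  proof -
    have "(\<lambda>x. x 0) \<in> PiM {0} ?N \<rightarrow>\<^sub>M euclid m"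
      using measurable_component_singleton[of 0 "{0}" ?N] by simp
    then have "(\<lambda>x. x 0 k) \<in> borel_measurable (PiM {0} ?N)" if "k \<in> {1..m}" for k
      using measurable_compose[OF _ measurable_component_singleton[OF that]] by blast
    then show ?thesis
      using ij by (intro measurable_compose[OF _ measurable_ennreal] borel_measurable_times)
  qed
  moreover have "?g \<in> borel_measurable (PiM {i, j} ?N)"
  proof -
    have "(\<lambda>x. x k a) \<in> borel_measurable (PiM {i, j} ?N)" if "k \<in> {i, j}" "a \<in> {1..d}" for k a
    proof -
      have "?N k = euclid d"
        using that ij by auto
      then have "(\<lambda>x. x k) \<in> PiM {i, j} ?N \<rightarrow>\<^sub>M euclid d"
        using measurable_component_singleton[OF that(1), of ?N] by simp
      then show ?thesis
        using measurable_compose[OF _ measurable_component_singleton[OF that(2)]] by blast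
    qed
    then show ?thesis
      by (intro measurable_compose[OF _ measurable_ennreal] borel_measurable_abs
          borel_measurable_sum borel_measurable_times) auto
  qed
  ultimately have "indep_var borel (?f \<circ> (\<lambda>\<omega>. restrict (\<lambda>k. ?X k \<omega>) {0}))
      borel (?g \<circ> (\<lambda>\<omega>. restrict (\<lambda>k. ?X k \<omega>) {i, j}))"
    by (rule indep_var_compose)
  then have indep: "indep_var borel (\<lambda>\<omega>. ennreal (L \<omega> i * L \<omega> j))
      borel (\<lambda>\<omega>. ennreal \<bar>\<Sum>a = 1..d. U i \<omega> a * U j \<omega> a\<bar>)"
    using ij by (simp add: o_def)
  have "indep_var (PiM {i} ?N) (\<lambda>\<omega>. restrict (\<lambda>k. ?X k \<omega>) {i})
      (PiM {j} ?N) (\<lambda>\<omega>. restrict (\<lambda>k. ?X k \<omega>) {j})"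
    by (rule indep_var_restrict[OF ind']) (use ij in auto)
  then have "indep_var (?N i) ((\<lambda>x. x i) \<circ> (\<lambda>\<omega>. restrict (\<lambda>k. ?X k \<omega>) {i}))
      (?N j) ((\<lambda>x. x j) \<circ> (\<lambda>\<omega>. restrict (\<lambda>k. ?X k \<omega>) {j}))"
    by (rule indep_var_compose) (rule measurable_component_singleton, simp)+
  then have indU: "indep_var (euclid d) (U i) (euclid d) (U j)"
    using ij by (simp add: o_def)
  note sq = unif_sphere_inner_second_moment[OF d U[OF ij(1)] U[OF ij(2)] indU]
  have "(\<lambda>\<omega>. U k \<omega> a) \<in> borel_measurable M" if "k \<in> {1..m}" "a \<in> {1..d}" for k a
    using U[OF that(1)] measurable_compose[OF _ measurable_component_singleton[OF that(2)]]
    by (auto simp: unif_sphere_def)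
  then have "(\<lambda>\<omega>. \<Sum>a = 1..d. U i \<omega> a * U j \<omega> a) \<in> borel_measurable M"
    using ij by (intro borel_measurable_sum borel_measurable_times) auto
  from nn_integral_abs_le_sqrt_second_moment[OF this sq(1)]
  have inner: "(\<integral>\<^sup>+ \<omega>. ennreal \<bar>\<Sum>a = 1..d. U i \<omega> a * U j \<omega> a\<bar> \<partial>M) \<le> ennreal (1 / sqrt (real d))"
    unfolding sq(2) by (simp add: real_sqrt_divide)
  have "(\<integral>\<^sup>+ \<omega>. ennreal \<bar>L \<omega> i * L \<omega> j * (\<Sum>a = 1..d. U i \<omega> a * U j \<omega> a)\<bar> \<partial>M) =
      (\<integral>\<^sup>+ \<omega>. ennreal (L \<omega> i * L \<omega> j) * ennreal \<bar>\<Sum>a = 1..d. U i \<omega> a * U j \<omega> a\<bar> \<partial>M)"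
    by (intro nn_integral_cong) (use L in \<open>simp add: abs_mult[of "L _ i * L _ j"] ennreal_mult\<close>)
  also have "\<dots> = (\<integral>\<^sup>+ \<omega>. ennreal (L \<omega> i * L \<omega> j) \<partial>M) *
      (\<integral>\<^sup>+ \<omega>. ennreal \<bar>\<Sum>a = 1..d. U i \<omega> a * U j \<omega> a\<bar> \<partial>M)"
    by (rule indep_var_nn_integral[OF indep])
  also have "\<dots> \<le> (\<integral>\<^sup>+ \<omega>. ennreal (L \<omega> i * L \<omega> j) \<partial>M) * ennreal (1 / sqrt (real d))"
    by (rule mult_left_mono[OF inner]) simp
  finally show ?thesis .
qed

text \<open>
  Expanding \<open>|\<Sum>k. L\<^sub>k U\<^sub>k|\<^sup>2\<close>, the diagonal terms are \<open>L\<^sub>k\<^sup>2 |U\<^sub>k|\<^sup>2 = L\<^sub>k\<^sup>2\<close> and cancel exactly against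
  \<open>|L|\<^sup>2\<close>. Only the mixed products \<open>L\<^sub>i L\<^sub>j\<close> remain, and these are what the moment bound controls.
\<close>

lemma weighted_sum_norm_deviation:
  assumes "\<And>k. k \<in> {1..m} \<Longrightarrow> (\<Sum>a = 1..d. (U k \<omega> a)\<^sup>2) = 1"
  shows "(enorm d (weighted_sum d m U L \<omega>))\<^sup>2 - (enorm m (L \<omega>))\<^sup>2 =
    (\<Sum>i = 1..m. \<Sum>j \<in> {1..m} - {i}. L \<omega> i * L \<omega> j * (\<Sum>a = 1..d. U i \<omega> a * U j \<omega> a))"
proof -
  let ?t = "\<lambda>i j. L \<omega> i * L \<omega> j * (\<Sum>a = 1..d. U i \<omega> a * U j \<omega> a)"
  have "(enorm d (weighted_sum d m U L \<omega>))\<^sup>2 = (\<Sum>a = 1..d. (\<Sum>k = 1..m. L \<omega> k * U k \<omega> a)\<^sup>2)"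
    by (simp add: L2_set_def weighted_sum_def sum_nonneg)
  also have "\<dots> = (\<Sum>a = 1..d. \<Sum>i = 1..m. \<Sum>j = 1..m. L \<omega> i * L \<omega> j * (U i \<omega> a * U j \<omega> a))"
    by (simp add: power2_eq_square sum_product mult_ac)
  also have "\<dots> = (\<Sum>i = 1..m. \<Sum>a = 1..d. \<Sum>j = 1..m. L \<omega> i * L \<omega> j * (U i \<omega> a * U j \<omega> a))"
    by (rule sum.swap)
  also have "\<dots> = (\<Sum>i = 1..m. \<Sum>j = 1..m. \<Sum>a = 1..d. L \<omega> i * L \<omega> j * (U i \<omega> a * U j \<omega> a))"
    by (rule sum.cong[OF refl], rule sum.swap)
  also have "\<dots> = (\<Sum>i = 1..m. \<Sum>j = 1..m. ?t i j)"
    by (simp add: sum_distrib_left)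
  also have "\<dots> = (\<Sum>i = 1..m. ?t i i + (\<Sum>j \<in> {1..m} - {i}. ?t i j))"
    by (rule sum.cong[OF refl], rule sum.remove) auto
  also have "\<dots> = (\<Sum>i = 1..m. (L \<omega> i)\<^sup>2) + (\<Sum>i = 1..m. \<Sum>j \<in> {1..m} - {i}. ?t i j)"
    using assms by (simp add: sum.distrib power2_eq_square)
  also have "(\<Sum>i = 1..m. (L \<omega> i)\<^sup>2) = (enorm m (L \<omega>))\<^sup>2"
    by (simp add: L2_set_def sum_nonneg)
  finally show ?thesis
    by simp
qed

text \<open>
  There are at most \<open>m\<^sup>2\<close> off-diagonal terms, and each contributes at most \<open>c / sqrt d\<close>.
\<close>

lemma (in prob_space) expected_norm_deviation:
  assumes d: "d \<ge> 1" and U: "\<And>k. k \<in> {1..m} \<Longrightarrow> unif_sphere M d (U k)"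
    and ind: "indep_vectors M d m U L"
    and L: "\<And>k \<omega>. k \<in> {1..m} \<Longrightarrow> \<omega> \<in> space M \<Longrightarrow> L \<omega> k \<ge> 0"
    and c: "c \<ge> 0" "\<And>i j. i \<in> {1..m} \<Longrightarrow> j \<in> {1..m} \<Longrightarrow> i \<noteq> j \<Longrightarrow>
      (\<integral>\<^sup>+ \<omega>. ennreal (L \<omega> i * L \<omega> j) \<partial>M) \<le> ennreal c"
  shows "(\<integral>\<^sup>+ \<omega>. ennreal \<bar>(enorm d (weighted_sum d m U L \<omega>))\<^sup>2 - (enorm m (L \<omega>))\<^sup>2\<bar> \<partial>M) \<le>
    ennreal ((real m)\<^sup>2 * c / sqrt (real d))"
proof -
  let ?t = "\<lambda>i j \<omega>. L \<omega> i * L \<omega> j * (\<Sum>a = 1..d. U i \<omega> a * U j \<omega> a)"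
  have Um: "(\<lambda>\<omega>. U k \<omega> a) \<in> borel_measurable M" if "k \<in> {1..m}" "a \<in> {1..d}" for k a
    using U[OF that(1)] measurable_compose[OF _ measurable_component_singleton[OF that(2)]]
    by (auto simp: unif_sphere_def)
  have "L \<in> M \<rightarrow>\<^sub>M euclid m"
    using ind unfolding indep_vectors_def indep_vars_def by (auto dest: bspec[of _ _ 0])
  then have Lm: "(\<lambda>\<omega>. L \<omega> k) \<in> borel_measurable M" if "k \<in> {1..m}" for k
    using measurable_compose[OF _ measurable_component_singleton[OF that]] by auto
  have tm: "?t i j \<in> borel_measurable M" if "i \<in> {1..m}" "j \<in> {1..m}" for i j
    using that by (intro borel_measurable_sum borel_measurable_times Um Lm) auto
  have "AE \<omega> in M. \<forall>k\<in>{1..m}. (\<Sum>a = 1..d. (U k \<omega> a)\<^sup>2) = 1"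
    by (rule AE_finite_allI) (simp_all only: finite_atLeastAtMost unif_sphere_norm[OF d U])
  then have "AE \<omega> in M. ennreal \<bar>(enorm d (weighted_sum d m U L \<omega>))\<^sup>2 - (enorm m (L \<omega>))\<^sup>2\<bar> \<le>
      (\<Sum>i = 1..m. \<Sum>j \<in> {1..m} - {i}. ennreal \<bar>?t i j \<omega>\<bar>)"
  proof eventually_elim
    case (elim \<omega>)
    have "\<bar>(enorm d (weighted_sum d m U L \<omega>))\<^sup>2 - (enorm m (L \<omega>))\<^sup>2\<bar> =
        \<bar>\<Sum>i = 1..m. \<Sum>j \<in> {1..m} - {i}. ?t i j \<omega>\<bar>"
      using weighted_sum_norm_deviation[of m U \<omega> d L] elim by simp
    also have "\<dots> \<le> (\<Sum>i = 1..m. \<Sum>j \<in> {1..m} - {i}. \<bar>?t i j \<omega>\<bar>)"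
      by (rule order_trans[OF sum_abs sum_mono[OF sum_abs]])
    finally show ?case
      by (simp add: sum_nonneg ennreal_leI)
  qed
  then have "(\<integral>\<^sup>+ \<omega>. ennreal \<bar>(enorm d (weighted_sum d m U L \<omega>))\<^sup>2 - (enorm m (L \<omega>))\<^sup>2\<bar> \<partial>M) \<le>
      (\<integral>\<^sup>+ \<omega>. (\<Sum>i = 1..m. \<Sum>j \<in> {1..m} - {i}. ennreal \<bar>?t i j \<omega>\<bar>) \<partial>M)"
    by (rule nn_integral_mono_AE)
  also have "\<dots> = (\<Sum>i = 1..m. \<integral>\<^sup>+ \<omega>. (\<Sum>j \<in> {1..m} - {i}. ennreal \<bar>?t i j \<omega>\<bar>) \<partial>M)"
    by (intro nn_integral_sum borel_measurable_sum
        measurable_compose[OF _ measurable_ennreal] borel_measurable_abs tm) auto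
  also have "\<dots> = (\<Sum>i = 1..m. \<Sum>j \<in> {1..m} - {i}. \<integral>\<^sup>+ \<omega>. ennreal \<bar>?t i j \<omega>\<bar> \<partial>M)"
    by (intro sum.cong refl nn_integral_sum
        measurable_compose[OF _ measurable_ennreal] borel_measurable_abs tm) auto
  also have "\<dots> \<le> (\<Sum>i = 1..m. \<Sum>j \<in> {1..m} - {i}. ennreal (c / sqrt (real d)))"
  proof (intro sum_mono)
    fix i j assume ij: "i \<in> {1..m}" "j \<in> {1..m} - {i}"
    have "(\<integral>\<^sup>+ \<omega>. ennreal \<bar>?t i j \<omega>\<bar> \<partial>M) \<le>
        (\<integral>\<^sup>+ \<omega>. ennreal (L \<omega> i * L \<omega> j) \<partial>M) * ennreal (1 / sqrt (real d))"
      by (rule weighted_inner_product_bound[OF d U ind]) (use ij L in auto)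
    also have "\<dots> \<le> ennreal c * ennreal (1 / sqrt (real d))"
      by (rule mult_right_mono[OF c(2)]) (use ij in auto)
    finally show "(\<integral>\<^sup>+ \<omega>. ennreal \<bar>?t i j \<omega>\<bar> \<partial>M) \<le> ennreal (c / sqrt (real d))"
      using c(1) by (simp add: ennreal_mult[symmetric])
  qed
  also have "\<dots> \<le> (\<Sum>i = 1..m. \<Sum>j = 1..m. ennreal (c / sqrt (real d)))"
    by (intro sum_mono sum_mono2) auto
  also have "\<dots> = (\<Sum>i = 1..m. ennreal (\<Sum>j = 1..m. c / sqrt (real d)))"
    using c(1) by (intro sum.cong refl sum_ennreal) simp
  also have "\<dots> = ennreal (\<Sum>i = 1..m. \<Sum>j = 1..m. c / sqrt (real d))"
    using c(1) by (intro sum_ennreal) (simp add: sum_nonneg)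
  finally show ?thesis
    by (simp add: power2_eq_square mult.assoc)
qed

section \<open>Convergence in probability\<close>

theorem theorem5p3:
  fixes M :: "'a measure"
    and n :: "nat \<Rightarrow> nat"
    and U :: "nat \<Rightarrow> nat \<Rightarrow> 'a \<Rightarrow> nat \<Rightarrow> real"
    and L :: "nat \<Rightarrow> 'a \<Rightarrow> nat \<Rightarrow> real"
    and \<psi> :: "real \<Rightarrow> real"
  assumes "prob_space M" and "complete_measure M"
    and "\<And>d. d \<ge> 2 \<Longrightarrow> n d \<ge> 1"
    and "mono_on {2..} n"
    and "\<And>d k. d \<ge> 2 \<Longrightarrow> k \<in> {1..n d} \<Longrightarrow> unif_sphere M d (U d k)"
    and "\<And>d k \<omega>. d \<ge> 2 \<Longrightarrow> k \<in> {1..n d} \<Longrightarrow> \<omega> \<in> space M \<Longrightarrow> L d \<omega> k \<ge> 0"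
    and "\<And>d. d \<ge> 2 \<Longrightarrow> indep_vectors M d (n d) (U d) (L d)"
    and "\<And>x. x \<ge> 0 \<Longrightarrow> \<psi> x \<ge> 0"
    and "\<And>d i j. d \<ge> 2 \<Longrightarrow> i \<in> {1..n d} \<Longrightarrow> j \<in> {1..n d} \<Longrightarrow> i \<noteq> j \<Longrightarrow>
           (\<integral>\<^sup>+ \<omega>. ennreal (L d \<omega> i * L d \<omega> j) \<partial>M) \<le> ennreal (\<psi> (real d))"
    and "(\<lambda>d. real d powr (-1/2) * \<psi> (real d) * (real (n d))\<^sup>2) \<longlonglongrightarrow> 0"
  shows "\<forall>\<epsilon>>0. (\<lambda>d. measure M {\<omega> \<in> space M.
           \<bar>(enorm d (weighted_sum d (n d) (U d) (L d) \<omega>))\<^sup>2 - (enorm (n d) (L d \<omega>))\<^sup>2\<bar> > \<epsilon>})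
           \<longlonglongrightarrow> 0"
proof (intro allI impI)
  interpret prob_space M
    by fact
  fix \<epsilon> :: real assume \<epsilon>: "\<epsilon> > 0"
  let ?D = "\<lambda>d \<omega>. \<bar>(enorm d (weighted_sum d (n d) (U d) (L d) \<omega>))\<^sup>2 - (enorm (n d) (L d \<omega>))\<^sup>2\<bar>"
  let ?b = "\<lambda>d. real d powr (-1/2) * \<psi> (real d) * (real (n d))\<^sup>2"
  have bound: "measure M {\<omega> \<in> space M. ?D d \<omega> > \<epsilon>} \<le> ?b d / \<epsilon>" if d: "d \<ge> 2" for d
  proof -
    have Um: "(\<lambda>\<omega>. U d k \<omega> a) \<in> borel_measurable M" if "k \<in> {1..n d}" "a \<in> {1..d}" for k a
      using assms(5)[OF d that(1)] measurable_compose[OF _ measurable_component_singleton[OF that(2)]]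
      by (auto simp: unif_sphere_def)
    have "L d \<in> M \<rightarrow>\<^sub>M euclid (n d)"
      using assms(7)[OF d] unfolding indep_vectors_def indep_vars_def by (auto dest: bspec[of _ _ 0])
    then have Lm: "(\<lambda>\<omega>. L d \<omega> k) \<in> borel_measurable M" if "k \<in> {1..n d}" for k
      using measurable_compose[OF _ measurable_component_singleton[OF that]] by auto
    have Dm: "?D d \<in> borel_measurable M"
    proof -
      have "(\<lambda>\<omega>. \<Sum>k = 1..n d. L d \<omega> k * U d k \<omega> a) \<in> borel_measurable M" if "a \<in> {1..d}" for a
        using that by (intro borel_measurable_sum borel_measurable_times Um Lm)
      then show ?thesis
        using Lm by (simp add: L2_set_def weighted_sum_def sum_nonneg)
    qed
    have "real d powr (-1/2) = 1 / sqrt (real d)"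
      by (simp add: powr_minus_divide powr_half_sqrt)
    then have b: "?b d = (real (n d))\<^sup>2 * \<psi> (real d) / sqrt (real d)"
      by simp
    have "(\<integral>\<^sup>+ \<omega>. ennreal (?D d \<omega>) \<partial>M) \<le> ennreal (?b d)"
      unfolding b
      by (rule expected_norm_deviation) (use d assms(5-9) in auto)
    moreover have "?b d \<ge> 0"
      using assms(8)[of "real d"] by simp
    ultimately have nn: "(\<integral>\<^sup>+ \<omega>. ennreal (?D d \<omega>) \<partial>M) \<le> ennreal (?b d)" and b0: "?b d \<ge> 0"
      by blast+
    have int: "integrable M (?D d)"
      using Dm nn by (intro integrableI_nonneg) (auto intro: le_less_trans)
    then have "ennreal (expectation (?D d)) \<le> ennreal (?b d)"
      using nn by (subst nn_integral_eq_integral[symmetric]) auto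
    then have exp: "expectation (?D d) \<le> ?b d"
      using b0 by (simp only: ennreal_le_iff)
    have "measure M {\<omega> \<in> space M. ?D d \<omega> > \<epsilon>} \<le> measure M {\<omega> \<in> space M. ?D d \<omega> \<ge> \<epsilon>}"
      using Dm by (intro finite_measure_mono) auto
    also have "\<dots> \<le> expectation (?D d) / \<epsilon>"
      using int \<epsilon> by (intro integral_Markov_inequality_measure[where A = "{}"]) auto
    also have "\<dots> \<le> ?b d / \<epsilon>"
      using exp \<epsilon> by (simp add: divide_right_mono)
    finally show ?thesis .
  qed
  show "(\<lambda>d. measure M {\<omega> \<in> space M. ?D d \<omega> > \<epsilon>}) \<longlonglongrightarrow> 0"
  proof (rule tendsto_sandwich[where f = "\<lambda>_. 0" and h = "\<lambda>d. ?b d / \<epsilon>"])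
    show "\<forall>\<^sub>F d in sequentially. measure M {\<omega> \<in> space M. ?D d \<omega> > \<epsilon>} \<le> ?b d / \<epsilon>"
      using eventually_ge_at_top[of 2] by eventually_elim (rule bound)
    show "(\<lambda>d. ?b d / \<epsilon>) \<longlonglongrightarrow> 0"
      using tendsto_divide[OF assms(10) tendsto_const[of \<epsilon>]] \<epsilon> by simp
  qed auto
qed

end
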